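(* Let $T_1,\ldots,T_n$ be commuting contractions on a complex Hilbert space $\mathcal{H}$, let $T=\prod_{i=1}^n T_i$, let $\mathcal{K}$ be the minimal isometric dilation space of $T$ and let $\mathcal{K}_*$ be the minimal isometric dilation space of $T^*$. Then $(T_1,\ldots,T_n)$ possesses an isometric dilation $(V_1,\ldots,V_n)$ on $\mathcal{K}$ with $V=\prod_{i=1}^n V_i$ being the minimal isometric dilation of $T$ if and only if $(T_1^*,\ldots,T_n^* )$ possesses an isometric dilation $(Y_1,\ldots,Y_n)$ on $\mathcal{K}_*$ with $Y=\prod_{i=1}^n Y_i$ being the minimal isometric dilation of $T^*$.
   Context: All operators are bounded linear operators on complex Hilbert spaces; a contraction is an operator of norm at most $1$. Isometric dilation: a commuting tuple of isometries $(V_1,\ldots,V_n)$ on a Hilbert space $\mathcal{K}$ is an isometric dilation of a commuting tuple of contractions $(T_1,\ldots,T_n)$ on $\mathcal{H}$ if $\mathcal{H}$ can be realized as a closed linear subspace of $\mathcal{K}$ and $T_1^{k_1}\cdots T_n^{k_n}=P_{\mathcal{H}}(V_1^{k_1}\cdots V_n^{k_n})|_{\mathcal{H}}$ for all non-negative integers $k_1,\ldots,k_n$, where $P_{\mathcal{H}}:\mathcal{K}\to\mathcal{H}$ is the orthogonal projection. It is minimal if $\mathcal{K}=\overline{\mathrm{Span}}\{V_1^{k_1}\cdots V_n^{k_n}h : h\in\mathcal{H},\ k_1,\ldots,k_n\in\mathbb{N}\cup\{0\}\}$. For a single contraction $T$ this is the case $n=1$; a minimal isometric dilation of $T$ exists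 and is unique up to unitary equivalence, and the space on which it acts is called the minimal isometric dilation space of $T$. *)

theory Defs
  imports "HOL-Analysis.Analysis"
begin

section \<open>Complex Hilbert spaces\<close>

class complex_vector = real_vector +
  fixes scaleC :: "complex \<Rightarrow> 'a \<Rightarrow> 'a" (infixr \<open>*\<^sub>C\<close> 75)
  assumes scaleC_add_right: "a *\<^sub>C (x + y) = a *\<^sub>C x + a *\<^sub>C y"
    and scaleC_add_left: "(a + b) *\<^sub>C x = a *\<^sub>C x + b *\<^sub>C x"
    and scaleC_scaleC: "a *\<^sub>C (b *\<^sub>C x) = (a * b) *\<^sub>C x"
    and scaleC_one: "1 *\<^sub>C x = x"
    and scaleR_scaleC: "r *\<^sub>R x = complex_of_real r *\<^sub>C x"

global_interpretation complex_vector: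
  vector_space "scaleC :: complex \<Rightarrow> 'a \<Rightarrow> 'a::complex_vector"
  by unfold_locales
    (simp_all add: scaleC_add_right scaleC_add_left scaleC_scaleC scaleC_one)

text \<open>
  The inner product is linear in its first argument.  The real inner product of the
  parent class is its real part, so that the norm and the topology are those induced by
  \<open>cinner\<close>; positivity and definiteness are inherited from \<^class>\<open>real_inner\<close>
  (see \<open>cinner_self\<close> below).
\<close>

class complex_inner = complex_vector + real_inner +
  fixes cinner :: "'a \<Rightarrow> 'a \<Rightarrow> complex"
  assumes cinner_commute: "cinner x y = cnj (cinner y x)"
    and cinner_add_left: "cinner (x + y) z = cinner x z + cinner y z"
    and cinner_scaleC_left: "cinner (a *\<^sub>C x) y = a * cinner x y"
    and inner_eq_Re_cinner: "inner x y = Re (cinner x y)"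

class chilbert_space = complex_inner + complete_space
begin

subclass banach ..

end

lemma cinner_self: "cinner x x = complex_of_real ((norm x)\<^sup>2)"
proof (rule complex_eqI)
  show "Re (cinner x x) = Re (complex_of_real ((norm x)\<^sup>2))"
    by (simp add: inner_eq_Re_cinner[symmetric] power2_norm_eq_inner)
  have "Im (cinner x x) = - Im (cinner x x)"
    using arg_cong[OF cinner_commute[of x x], of Im] by simp
  then show "Im (cinner x x) = Im (complex_of_real ((norm x)\<^sup>2))"
    by simp
qed

lemma cinner_diff_left: "cinner (x - y) z = cinner x z - cinner y z"
  by (metis add_diff_cancel_right' cinner_add_left diff_add_cancel)

lemma cinner_diff_right: "cinner z (x - y) = cinner z x - cinner z y"
  by (metis cinner_commute cinner_diff_left complex_cnj_diff)

instantiation complex :: chilbert_space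
begin

definition scaleC_complex :: "complex \<Rightarrow> complex \<Rightarrow> complex"
  where "scaleC_complex a x = a * x"

definition cinner_complex :: "complex \<Rightarrow> complex \<Rightarrow> complex"
  where "cinner_complex x y = x * cnj y"

instance
  by intro_classes
    (simp_all add: scaleC_complex_def cinner_complex_def inner_complex_def
      algebra_simps scaleR_conv_of_real)

end


section \<open>Operators\<close>

definition bounded_clinear :: "('a::complex_inner \<Rightarrow> 'b::complex_inner) \<Rightarrow> bool"
  where "bounded_clinear A \<longleftrightarrow>
    bounded_linear A \<and> (\<forall>c x. A (c *\<^sub>C x) = c *\<^sub>C A x)"

definition contraction :: "('a::complex_inner \<Rightarrow> 'b::complex_inner) \<Rightarrow> bool"
  where "contraction A \<longleftrightarrow> bounded_clinear A \<and> onorm A \<le> 1"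

definition isometry :: "('a::complex_inner \<Rightarrow> 'b::complex_inner) \<Rightarrow> bool"
  where "isometry A \<longleftrightarrow> bounded_clinear A \<and> (\<forall>x. norm (A x) = norm x)"

definition cadjoint :: "('a::chilbert_space \<Rightarrow> 'b::chilbert_space) \<Rightarrow> 'b \<Rightarrow> 'a"
  where "cadjoint A = (THE B. \<forall>x y. cinner (A x) y = cinner x (B y))"

lemma cadjoint_eqI:
  assumes "\<And>x y. cinner (A x) y = cinner x (B y)"
  shows "cadjoint A = B"
  unfolding cadjoint_def
proof (rule the_equality)
  fix C assume C: "\<forall>x y. cinner (A x) y = cinner x (C y)"
  show "C = B"
  proof
    fix y
    have "cinner (C y - B y) (C y - B y) = 0"
      using C assms by (metis cinner_diff_right right_minus_eq)
    then show "C y = B y"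
      by (simp add: cinner_self)
  qed
qed (use assms in blast)

definition orth_proj :: "'a::chilbert_space set \<Rightarrow> 'a \<Rightarrow> 'a"
  where "orth_proj M x = (THE y. y \<in> M \<and> (\<forall>z\<in>M. cinner (x - y) z = 0))"

text \<open>Tuples \<open>(A\<^sub>1, \<dots>, A\<^sub>n)\<close> are functions on \<^typ>\<open>nat\<close>,
  of which only the values at \<open>1, \<dots>, n\<close> matter.\<close>

primrec op_prod :: "(nat \<Rightarrow> 'a \<Rightarrow> 'a) \<Rightarrow> nat \<Rightarrow> 'a \<Rightarrow> 'a"
  where
    "op_prod A 0 = id"
  | "op_prod A (Suc n) = op_prod A n \<circ> A (Suc n)"

definition op_monomial :: "nat \<Rightarrow> (nat \<Rightarrow> 'a \<Rightarrow> 'a) \<Rightarrow> (nat \<Rightarrow> nat) \<Rightarrow> 'a \<Rightarrow> 'a"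
  where "op_monomial n A k = op_prod (\<lambda>i. A i ^^ k i) n"

definition commuting :: "nat \<Rightarrow> (nat \<Rightarrow> 'a \<Rightarrow> 'a) \<Rightarrow> bool"
  where "commuting n A \<longleftrightarrow> (\<forall>i\<in>{1..n}. \<forall>j\<in>{1..n}. A i \<circ> A j = A j \<circ> A i)"


section \<open>Isometric dilations\<close>

text \<open>
  The realization of \<open>H\<close> as a closed subspace of \<open>K\<close> is a linear isometry
  \<open>J\<close> from \<open>H\<close> into \<open>K\<close>, whose range is closed because \<open>H\<close> is complete.
\<close>

definition isometric_dilation ::
    "nat \<Rightarrow> ('h::chilbert_space \<Rightarrow> 'k::chilbert_space) \<Rightarrow>
      (nat \<Rightarrow> 'k \<Rightarrow> 'k) \<Rightarrow> (nat \<Rightarrow> 'h \<Rightarrow> 'h) \<Rightarrow> bool"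
  where "isometric_dilation n J V T \<longleftrightarrow>
    isometry J \<and> (\<forall>i\<in>{1..n}. isometry (V i)) \<and> commuting n V \<and>
    (\<forall>k h. J (op_monomial n T k h) = orth_proj (range J) (op_monomial n V k (J h)))"

definition minimal_isometric_dilation ::
    "nat \<Rightarrow> ('h::chilbert_space \<Rightarrow> 'k::chilbert_space) \<Rightarrow>
      (nat \<Rightarrow> 'k \<Rightarrow> 'k) \<Rightarrow> (nat \<Rightarrow> 'h \<Rightarrow> 'h) \<Rightarrow> bool"
  where "minimal_isometric_dilation n J V T \<longleftrightarrow>
    isometric_dilation n J V T \<and>
    closure (complex_vector.span {op_monomial n V k (J h) | k h. True}) = UNIV"

definition minimal_isometric_dilation1 ::
    "('h::chilbert_space \<Rightarrow> 'k::chilbert_space) \<Rightarrow> ('k \<Rightarrow> 'k) \<Rightarrow> ('h \<Rightarrow> 'h) \<Rightarrow> bool"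
  where "minimal_isometric_dilation1 J V T \<longleftrightarrow>
    minimal_isometric_dilation 1 J (\<lambda>_. V) (\<lambda>_. T)"

end

theory Submission
  imports Defs
begin

text \<open>
  Write \<open>H\<close> for the space of the \<open>T\<^sub>i\<close>, and let \<open>V\<^sub>1, \<dots>, V\<^sub>n\<close> on \<open>K \<supseteq> H\<close> dilate
  \<open>T\<^sub>1, \<dots>, T\<^sub>n\<close> so that \<open>V = V\<^sub>1 \<cdots> V\<^sub>n\<close> is the minimal isometric dilation of
  \<open>T = T\<^sub>1 \<cdots> T\<^sub>n\<close>.  The \<open>V\<^sub>i\<close> extend to commuting unitaries \<open>U\<^sub>i\<close> on the space of the minimal
  unitary extension \<open>U = U\<^sub>1 \<cdots> U\<^sub>n\<close> of \<open>V\<close>, and the closed span \<open>K\<^sub>*\<close> of the \<open>U\<^sup>-\<^sup>m H\<close> is a minimal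
  isometric dilation space of the adjoint of \<open>T\<close>, with dilation \<open>U\<^sup>-\<^sup>1\<close>.  The dual dilation is
  formed by the restrictions of the inverses of the \<open>U\<^sub>i\<close> to \<open>K\<^sub>*\<close>.

  The point to prove is that these inverses leave \<open>K\<^sub>*\<close> invariant.  Minimality of \<open>V\<close> makes
  \<open>H\<close> invariant under the adjoint of every \<open>V\<^sub>i\<close> (lemma \<open>J_coinvariant\<close>).  A monomial \<open>V\<^sup>k\<close> that
  divides \<open>V\<^sup>m\<close> therefore maps \<open>H\<close> into the closed span of \<open>H, V H, \<dots>, V\<^sup>m H\<close> (lemma
  \<open>monomial_in_initial_space\<close>).  Apply \<open>U\<^sup>-\<^sup>m\<close>: every monomial in the inverses of the \<open>U\<^sub>i\<close>
  maps \<open>H\<close> into the closed span of \<open>U\<^sup>-\<^sup>m H, \<dots>, H\<close>, hence into \<open>K\<^sub>*\<close>.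

  The unitaries \<open>U\<^sub>i\<close> are not constructed.  With a multi-exponent \<open>p\<close>, the vector \<open>U\<^sup>-\<^sup>p h\<close> is
  characterised by its inner products with the vectors \<open>U\<^sup>-\<^sup>j h'\<close>, which are those of \<open>V\<^sup>j h\<close>
  with \<open>V\<^sup>p h'\<close>.  This singles out a vector \<open>neg_monomial p h\<close> of any given minimal isometric
  dilation space of the adjoint of \<open>T\<close>, and \<open>neg_monomial_cinner\<close> computes all inner products
  between such vectors.  These do not change when \<open>1\<close> is added to the same coordinate of both
  exponents, so raising the \<open>i\<close>-th exponent is an isometry \<open>Y\<^sub>i\<close>; commutativity, the product
  and the dilation property can be read off from the exponents (lemma \<open>dual_dilation_exists\<close>).

  The argument uses the \<open>T\<^sub>i\<close> and their adjoints symmetrically, so both directions of the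
  equivalence are instances of it.
\<close>

section \<open>Geometry of complex Hilbert spaces\<close>

lemma cinner_flip: "cinner a b = cinner c d \<Longrightarrow> cinner b a = cinner d c"
  by (subst (1 2) cinner_commute) simp

lemma cinner_add_right: "cinner x (y + z) = cinner x y + cinner x z"
  by (metis cinner_add_left cinner_commute complex_cnj_add)

lemma cinner_scaleC_right: "cinner x (c *\<^sub>C y) = cnj c * cinner x y"
  by (metis cinner_commute cinner_scaleC_left complex_cnj_mult)

lemma cinner_zero_left [simp]: "cinner 0 x = 0"
  using cinner_diff_left[of 0 0 x] by simp

lemma cinner_zero_right [simp]: "cinner x 0 = 0"
  using cinner_diff_right[of x 0 0] by simp

lemma cinner_self_eq_0_iff: "cinner x x = 0 \<longleftrightarrow> x = 0"
  by (simp add: cinner_self)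

lemma norm_scaleC: "norm (c *\<^sub>C x) = cmod c * norm (x :: 'a::complex_inner)"
proof -
  have "complex_of_real ((norm (c *\<^sub>C x))\<^sup>2) = c * cnj c * cinner x x"
    by (simp only: cinner_self[symmetric] cinner_scaleC_left cinner_scaleC_right mult_ac)
  also have "\<dots> = complex_of_real ((cmod c * norm x)\<^sup>2)"
    by (simp only: cinner_self complex_norm_square of_real_mult power_mult_distrib)
  finally show ?thesis
    by (simp only: of_real_eq_iff) (simp add: power2_eq_iff_nonneg)
qed

lemma Im_cinner: "Im (cinner x y) = inner x (\<i> *\<^sub>C y)"
  unfolding inner_eq_Re_cinner cinner_scaleC_right by simp

lemma cinner_eq: "cinner x y = Complex (inner x y) (inner x (\<i> *\<^sub>C y))"
  by (rule complex_eqI) (simp_all add: Im_cinner inner_eq_Re_cinner[symmetric])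

lemma tendsto_scaleC:
  fixes f :: "'b \<Rightarrow> 'a::complex_inner"
  assumes "(f \<longlongrightarrow> a) F"
  shows "((\<lambda>x. c *\<^sub>C f x) \<longlongrightarrow> c *\<^sub>C a) F"
proof -
  have "((\<lambda>x. cmod c * norm (f x - a)) \<longlongrightarrow> cmod c * 0) F"
    using assms by (intro tendsto_mult tendsto_const) (metis LIM_zero tendsto_norm_zero)
  moreover have "c *\<^sub>C f x - c *\<^sub>C a = c *\<^sub>C (f x - a)" for x
    by (simp add: complex_vector.scale_right_diff_distrib)
  ultimately have "((\<lambda>x. norm (c *\<^sub>C f x - c *\<^sub>C a)) \<longlongrightarrow> 0) F"
    by (simp add: norm_scaleC)
  then show ?thesis
    by (metis LIM_zero_cancel tendsto_norm_zero_iff)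
qed

lemma tendsto_cinner:
  assumes "(f \<longlongrightarrow> a) F" and "(g \<longlongrightarrow> b) F"
  shows "((\<lambda>x. cinner (f x) (g x)) \<longlongrightarrow> cinner a b) F"
  unfolding cinner_eq
  by (intro tendsto_Complex tendsto_inner tendsto_scaleC assms)

lemma subspace_closure_span:
  "complex_vector.subspace (closure (complex_vector.span (S :: 'a::complex_inner set)))"
    (is "complex_vector.subspace (closure ?M)")
proof (rule complex_vector.subspaceI)
  show "0 \<in> closure ?M"
    using closure_subset complex_vector.span_zero by blast
next
  fix x y assume "x \<in> closure ?M" "y \<in> closure ?M"
  then obtain f g where "\<forall>n::nat. f n \<in> ?M" "f \<longlonglongrightarrow> x" "\<forall>n::nat. g n \<in> ?M" "g \<longlonglongrightarrow> y"
    unfolding closure_sequential by auto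
  then show "x + y \<in> closure ?M"
    unfolding closure_sequential
    by (intro exI[of _ "\<lambda>n. f n + g n"]) (auto intro: complex_vector.span_add tendsto_add)
next
  fix c and x assume "x \<in> closure ?M"
  then obtain f where "\<forall>n::nat. f n \<in> ?M" "f \<longlonglongrightarrow> x"
    unfolding closure_sequential by auto
  then show "c *\<^sub>C x \<in> closure ?M"
    unfolding closure_sequential
    by (intro exI[of _ "\<lambda>n. c *\<^sub>C f n"]) (auto intro: complex_vector.span_scale tendsto_scaleC)
qed

text \<open>
  Reduces a linear and continuous assertion about a total set to its members.
\<close>

lemma closure_span_induct [consumes 1, case_names base zero add scale lim]:
  fixes P :: "'a::complex_inner \<Rightarrow> bool"
  assumes "x \<in> closure (complex_vector.span S)"
    and base: "\<And>x. x \<in> S \<Longrightarrow> P x"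
    and zero: "P 0"
    and add: "\<And>x y. P x \<Longrightarrow> P y \<Longrightarrow> P (x + y)"
    and scale: "\<And>c x. P x \<Longrightarrow> P (c *\<^sub>C x)"
    and lim: "\<And>f x. (\<And>n::nat. P (f n)) \<Longrightarrow> f \<longlonglongrightarrow> x \<Longrightarrow> P x"
  shows "P x"
proof -
  have span: "P y" if "y \<in> complex_vector.span S" for y
    using that by (induction rule: complex_vector.span_induct_alt) (auto intro: assms)
  obtain f where "\<forall>n::nat. f n \<in> complex_vector.span S" "f \<longlonglongrightarrow> x"
    using assms(1) unfolding closure_sequential by auto
  then show ?thesis
    using lim span by blast
qed

text \<open>
  The point of a closed subspace nearest to \<open>x\<close> exists because, by the parallelogram law, every
  minimising sequence is Cauchy.  It is the projection: moving it within the subspace cannot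
  decrease the distance, which gives orthogonality for the real inner product, and multiplying by
  \<open>\<i>\<close> extends this to the complex one.
\<close>

lemma orthogonal_projection_exists:
  fixes M :: "'a::chilbert_space set"
  assumes M: "complex_vector.subspace M" "closed M"
  obtains y where "y \<in> M" "\<And>z. z \<in> M \<Longrightarrow> cinner (x - y) z = 0"
proof -
  define d where "d = infdist x M"
  have "M \<noteq> {}"
    using complex_vector.subspace_0[OF M(1)] by blast
  have d_le: "d \<le> norm (x - y)" if "y \<in> M" for y
    using infdist_le[OF that, of x] by (simp add: d_def dist_norm)
  have "d \<ge> 0"
    by (simp add: d_def infdist_nonneg)
  have scaleR: "r *\<^sub>R y \<in> M" if "y \<in> M" for r y
    using that by (simp add: scaleR_scaleC complex_vector.subspace_scale[OF M(1)])
  have add: "y + z \<in> M" if "y \<in> M" "z \<in> M" for y z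
    using that by (simp add: complex_vector.subspace_add[OF M(1)])
  have "\<exists>y\<in>M. (norm (x - y))\<^sup>2 < d\<^sup>2 + inverse (real (Suc m))" for m
  proof -
    have "d < sqrt (d\<^sup>2 + inverse (real (Suc m)))"
      using \<open>d \<ge> 0\<close> by (intro real_less_rsqrt) simp
    then obtain y where "y \<in> M" "dist x y < sqrt (d\<^sup>2 + inverse (real (Suc m)))"
      using cInf_lessD[of "dist x ` M"] \<open>M \<noteq> {}\<close> unfolding d_def infdist_def by auto
    then show ?thesis
      by (metis dist_norm norm_ge_zero real_sqrt_less_iff real_sqrt_unique)
  qed
  then obtain f where f: "\<And>m. f m \<in> M" "\<And>m. (norm (x - f m))\<^sup>2 < d\<^sup>2 + inverse (real (Suc m))"
    by metis
  have dist_f: "(norm (f k - f l))\<^sup>2 \<le> 2 * inverse (real (Suc k)) + 2 * inverse (real (Suc l))" for k l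
  proof -
    have "d\<^sup>2 \<le> (norm (x - (1/2) *\<^sub>R (f k + f l)))\<^sup>2"
      using d_le[OF scaleR[OF add[OF f(1) f(1)]]] \<open>d \<ge> 0\<close> by (intro power_mono) auto
    moreover have "(norm (f k - f l))\<^sup>2 = 2 * (norm (x - f k))\<^sup>2 + 2 * (norm (x - f l))\<^sup>2
        - 4 * (norm (x - (1/2) *\<^sub>R (f k + f l)))\<^sup>2"
      by (simp add: power2_norm_eq_inner inner_simps inner_commute algebra_simps)
    ultimately show ?thesis
      using f(2)[of k] f(2)[of l] by linarith
  qed
  have "Cauchy f"
  proof (rule metric_CauchyI)
    fix e :: real assume "e > 0"
    then obtain N where N: "inverse (real (Suc N)) < e\<^sup>2 / 4"
      using reals_Archimedean[of "e\<^sup>2 / 4"] by auto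
    show "\<exists>N. \<forall>k\<ge>N. \<forall>l\<ge>N. dist (f k) (f l) < e"
    proof (intro exI allI impI)
      fix k l assume "k \<ge> N" "l \<ge> N"
      then have "inverse (real (Suc k)) \<le> inverse (real (Suc N))"
          "inverse (real (Suc l)) \<le> inverse (real (Suc N))"
        by (auto intro!: le_imp_inverse_le)
      then have "(norm (f k - f l))\<^sup>2 < e\<^sup>2"
        using dist_f[of k l] N by linarith
      then show "dist (f k) (f l) < e"
        using \<open>e > 0\<close> by (metis dist_norm less_imp_le power_less_imp_less_base)
    qed
  qed
  then obtain y where y: "f \<longlonglongrightarrow> y"
    using Cauchy_convergent convergent_def by blast
  have "y \<in> M"
    using closed_sequentially[OF M(2) f(1) y] .
  have "(norm (x - y))\<^sup>2 \<le> d\<^sup>2 + 0"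
  proof (rule tendsto_le)
    show "(\<lambda>m. d\<^sup>2 + inverse (real (Suc m))) \<longlonglongrightarrow> d\<^sup>2 + 0"
      by (intro tendsto_add tendsto_const LIMSEQ_inverse_real_of_nat)
    show "(\<lambda>m. (norm (x - f m))\<^sup>2) \<longlonglongrightarrow> (norm (x - y))\<^sup>2"
      by (intro tendsto_intros y)
  qed (use f(2) in \<open>auto intro!: eventuallyI less_imp_le simp del: of_nat_Suc\<close>)
  then have nearest: "(norm (x - y))\<^sup>2 \<le> (norm (x - w))\<^sup>2" if "w \<in> M" for w
    using power_mono[OF d_le[OF that] \<open>d \<ge> 0\<close>, of 2] by linarith
  have real_orth: "inner (x - y) z = 0" if "z \<in> M" for z
  proof (cases "z = 0")
    case False
    define t where "t = inner (x - y) z / inner z z"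
    have nz: "inner z z > 0"
      using False by simp
    \<comment> \<open>\<open>t\<close> minimises the distance from \<open>x\<close> along the line through \<open>y\<close> in direction \<open>z\<close>.\<close>
    have "(norm (x - y))\<^sup>2 \<le> (norm (x - (y + t *\<^sub>R z)))\<^sup>2"
      by (intro nearest add scaleR that \<open>y \<in> M\<close>)
    also have "x - (y + t *\<^sub>R z) = (x - y) - t *\<^sub>R z"
      by simp
    also have "(norm \<dots>)\<^sup>2 = (norm (x - y))\<^sup>2 - 2 * t * inner (x - y) z + t\<^sup>2 * inner z z"
      unfolding power2_norm_eq_inner
      by (simp add: inner_diff_left inner_diff_right inner_commute power2_eq_square)
    also have "\<dots> = (norm (x - y))\<^sup>2 - (inner (x - y) z)\<^sup>2 / inner z z"
      using nz by (simp add: t_def power2_eq_square)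
    finally have "(inner (x - y) z)\<^sup>2 / inner z z \<le> 0"
      by simp
    then show ?thesis
      using nz by (simp add: divide_le_0_iff)
  qed simp
  show thesis
  proof (rule that[OF \<open>y \<in> M\<close>])
    fix z assume "z \<in> M"
    then show "cinner (x - y) z = 0"
      unfolding cinner_eq
      using real_orth complex_vector.subspace_scale[OF M(1)] by (simp add: zero_complex.code)
  qed
qed

text \<open>
  The difference of \<open>x\<close> and its projection onto the closed span is an admissible \<open>y\<close>, so it is
  orthogonal to \<open>x\<close> as well as to the projection, hence to itself.
\<close>

lemma mem_closure_spanI:
  fixes x :: "'a::chilbert_space"
  assumes "\<And>y. (\<And>s. s \<in> S \<Longrightarrow> cinner s y = 0) \<Longrightarrow> cinner x y = 0"
  shows "x \<in> closure (complex_vector.span S)"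
proof -
  obtain y where y: "y \<in> closure (complex_vector.span S)"
      "\<And>z. z \<in> closure (complex_vector.span S) \<Longrightarrow> cinner (x - y) z = 0"
    using orthogonal_projection_exists[OF subspace_closure_span closed_closure] by blast
  have "cinner s (x - y) = 0" if "s \<in> S" for s
    by (metis cinner_commute closure_subset complex_cnj_zero complex_vector.span_base subsetD that y(2))
  then have "cinner x (x - y) = 0"
    by (rule assms)
  then have "cinner (x - y) (x - y) = 0"
    using y(2)[OF y(1)] cinner_commute[of y "x - y"] by (simp add: cinner_diff_left)
  then show ?thesis
    using y(1) by (simp add: cinner_self_eq_0_iff)
qed

text \<open>
  The kernel of a nonzero functional has a one-dimensional orthogonal complement, and the
  representing vector is a multiple of any nonzero vector \<open>w\<close> in it.
\<close>

lemma riesz_representation: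
  fixes f :: "'a::chilbert_space \<Rightarrow> complex"
  assumes "bounded_linear f" and clinear: "\<And>c x. f (c *\<^sub>C x) = c * f x"
  obtains z where "\<And>x. f x = cinner x z"
proof (cases "\<forall>x. f x = 0")
  case True
  then show thesis
    using that[of 0] by simp
next
  case False
  then obtain x0 where x0: "f x0 \<noteq> 0"
    by blast
  interpret bounded_linear f by fact
  let ?M = "{x. f x = 0}"
  have "complex_vector.subspace ?M"
    by (auto simp: complex_vector.subspace_def clinear add)
  moreover have "closed ?M"
    by (intro closed_Collect_eq continuous_on continuous_on_const continuous_on_id)
  ultimately obtain y where y: "f y = 0" "\<And>z. f z = 0 \<Longrightarrow> cinner (x0 - y) z = 0"
    using orthogonal_projection_exists[of ?M x0] by auto
  define w where "w = x0 - y"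
  have fw: "f w \<noteq> 0"
    using x0 y(1) by (simp add: w_def diff)
  then have ww: "cinner w w \<noteq> 0"
    by (auto simp: cinner_self_eq_0_iff)
  have "f x = cinner x ((cnj (f w) / cnj (cinner w w)) *\<^sub>C w)" for x
  proof -
    have "cinner w (x - (f x / f w) *\<^sub>C w) = 0"
      using y(2) fw by (simp add: w_def[symmetric] diff clinear)
    then have "cinner (x - (f x / f w) *\<^sub>C w) w = 0"
      by (metis cinner_commute complex_cnj_zero)
    then have "cinner x w = (f x / f w) * cinner w w"
      by (simp add: cinner_diff_left cinner_scaleC_left)
    then show ?thesis
      using fw ww by (simp add: cinner_scaleC_right)
  qed
  then show thesis
    by (rule that)
qed

text \<open>
  The factor \<open>2\<close> comes from estimating real and imaginary part separately; for
  boundedness any constant will do.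
\<close>

lemma norm_cinner_le: "cmod (cinner x y) \<le> 2 * norm x * norm y"
proof -
  have "cmod (cinner x y) \<le> \<bar>Re (cinner x y)\<bar> + \<bar>Im (cinner x y)\<bar>"
    by (rule cmod_le)
  also have "\<dots> \<le> norm x * norm y + norm x * norm (\<i> *\<^sub>C y)"
    unfolding inner_eq_Re_cinner[symmetric] Im_cinner
    by (intro add_mono Cauchy_Schwarz_ineq2)
  finally show ?thesis
    by (simp add: norm_scaleC)
qed

lemma adjoint_vector_exists:
  fixes A :: "'a::chilbert_space \<Rightarrow> 'b::chilbert_space"
  assumes "bounded_clinear A"
  obtains z where "\<And>x. cinner (A x) y = cinner x z"
proof -
  interpret bounded_linear A
    using assms by (simp add: bounded_clinear_def)
  obtain K where K: "\<And>x. norm (A x) \<le> norm x * K"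
    using bounded by blast
  have "bounded_linear (\<lambda>x. cinner (A x) y)"
  proof (rule bounded_linear_intro)
    show "cinner (A (r *\<^sub>R x)) y = r *\<^sub>R cinner (A x) y" for r x
      unfolding scaleR by (simp add: scaleR_scaleC cinner_scaleC_left scaleC_complex_def)
    show "cmod (cinner (A x) y) \<le> norm x * (2 * K * norm y)" for x
    proof -
      have "cmod (cinner (A x) y) \<le> 2 * norm (A x) * norm y"
        by (rule norm_cinner_le)
      also have "\<dots> \<le> 2 * (norm x * K) * norm y"
        by (intro mult_right_mono mult_left_mono K) auto
      finally show ?thesis
        by (simp add: mult_ac)
    qed
  qed (simp add: add cinner_add_left)
  moreover have "cinner (A (c *\<^sub>C x)) y = c * cinner (A x) y" for c x
    using assms by (simp add: bounded_clinear_def cinner_scaleC_left)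
  ultimately show thesis
    using riesz_representation that by blast
qed

lemma cinner_cadjoint:
  assumes "bounded_clinear A"
  shows "cinner (A x) y = cinner x (cadjoint A y)"
proof -
  have "\<exists>z. \<forall>x. cinner (A x) y = cinner x z" for y
    using adjoint_vector_exists[OF assms] by metis
  then obtain B where "\<And>x y. cinner (A x) y = cinner x (B y)"
    by metis
  then show ?thesis
    using cadjoint_eqI by metis
qed

section \<open>Isometries and total sets\<close>

lemma isometry_clinear:
  assumes "isometry A"
  shows "A (x + y) = A x + A y" and "A (c *\<^sub>C x) = c *\<^sub>C A x" and "A 0 = 0"
    and "norm (A x) = norm x" and "bounded_clinear A"
  using assms
  by (auto simp: isometry_def bounded_clinear_def linear_simps)

lemma bounded_clinear_tendsto:
  assumes "bounded_clinear A" and "(f \<longlongrightarrow> x) F"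
  shows "((\<lambda>t. A (f t)) \<longlongrightarrow> A x) F"
  using assms by (auto simp: bounded_clinear_def intro: bounded_linear.tendsto)

lemma isometry_cinner:
  assumes "isometry A"
  shows "cinner (A x) (A y) = cinner x y"
proof -
  have "inner (A x) (A y) = inner x y" for x y
    using assms by (simp add: dot_norm isometry_clinear(1)[symmetric] isometry_clinear(4))
  then show ?thesis
    unfolding cinner_eq using isometry_clinear(2)[OF assms] by metis
qed

lemma isometryI:
  assumes add: "\<And>x y. A (x + y) = A x + A y"
    and scale: "\<And>c x. A (c *\<^sub>C x) = c *\<^sub>C A x"
    and norm: "\<And>x. norm (A x) = norm x"
  shows "isometry A"
proof -
  have "bounded_linear A"
    by (rule bounded_linear_intro[where K = 1]) (simp_all add: assms scaleR_scaleC)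
  then show ?thesis
    by (simp add: isometry_def bounded_clinear_def assms)
qed

lemma isometry_id: "isometry id"
  by (rule isometryI) auto

lemma isometry_comp: "isometry A \<Longrightarrow> isometry B \<Longrightarrow> isometry (A \<circ> B)"
  by (intro isometryI) (auto simp: isometry_clinear)

lemma isometry_funpow: "isometry A \<Longrightarrow> isometry (A ^^ k)" for A :: "'a::complex_inner \<Rightarrow> 'a"
  by (induction k) (auto intro: isometry_comp isometry_id)

lemma isometry_op_prod: "(\<And>i. i \<in> {1..n} \<Longrightarrow> isometry (A i)) \<Longrightarrow> isometry (op_prod A n)"
  by (induction n) (auto intro: isometry_comp isometry_id)

lemma total_cinner_eqI:
  fixes u v :: "'a::complex_inner"
  assumes total: "closure (complex_vector.span S) = UNIV"
    and eq: "\<And>s. s \<in> S \<Longrightarrow> cinner u s = cinner v s"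
  shows "u = v"
proof -
  have "cinner u x = cinner v x" if "x \<in> closure (complex_vector.span S)" for x
    using that
  proof (induction rule: closure_span_induct)
    case (lim f x)
    then show ?case
      using tendsto_cinner[OF tendsto_const lim(2), of u] tendsto_cinner[OF tendsto_const lim(2), of v]
      by (simp add: LIMSEQ_unique)
  qed (simp_all add: eq cinner_add_right cinner_scaleC_right)
  then have "cinner (u - v) (u - v) = 0"
    by (simp add: total cinner_diff_left)
  then show ?thesis
    by (simp add: cinner_self_eq_0_iff)
qed

lemma total_isometry_eqI:
  assumes total: "closure (complex_vector.span S) = UNIV"
    and AB: "isometry A" "isometry B" and eq: "\<And>s. s \<in> S \<Longrightarrow> A s = B s"
  shows "A = B"
proof
  fix x
  have "x \<in> closure (complex_vector.span S)"
    by (simp add: total)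
  then show "A x = B x"
  proof (induction rule: closure_span_induct)
    case (lim f x)
    show ?case
      using bounded_clinear_tendsto[OF isometry_clinear(5)[OF AB(1)] lim(2)]
        bounded_clinear_tendsto[OF isometry_clinear(5)[OF AB(2)] lim(2)]
      by (simp add: lim(1) LIMSEQ_unique)
  qed (simp_all add: eq isometry_clinear AB)
qed

section \<open>Families with equal Gram matrices\<close>

text \<open>
  The closed linear span of the pairs \<open>(a i, b i)\<close>.  If the two families have the same Gram matrix,
  it is the graph of the isometry between their closed spans that takes \<open>a i\<close> to \<open>b i\<close>.  Having
  closedness under limits as a rule lets statements about that isometry be proved by induction,
  also when the \<open>a i\<close> are not total.
\<close>

inductive gram_rel ::
    "'i set \<Rightarrow> ('i \<Rightarrow> 'a::complex_inner) \<Rightarrow> ('i \<Rightarrow> 'b::complex_inner) \<Rightarrow> 'a \<Rightarrow> 'b \<Rightarrow> bool"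
  for X a b where
    base: "i \<in> X \<Longrightarrow> gram_rel X a b (a i) (b i)"
  | zero: "gram_rel X a b 0 0"
  | add: "gram_rel X a b x y \<Longrightarrow> gram_rel X a b x' y' \<Longrightarrow> gram_rel X a b (x + x') (y + y')"
  | scale: "gram_rel X a b x y \<Longrightarrow> gram_rel X a b (c *\<^sub>C x) (c *\<^sub>C y)"
  | lim: "(\<And>k::nat. gram_rel X a b (f k) (g k)) \<Longrightarrow> f \<longlonglongrightarrow> x \<Longrightarrow> g \<longlonglongrightarrow> y \<Longrightarrow> gram_rel X a b x y"

context
  fixes X :: "'i set" and a :: "'i \<Rightarrow> 'a::complex_inner" and b :: "'i \<Rightarrow> 'b::chilbert_space"
  assumes gram: "\<And>i j. i \<in> X \<Longrightarrow> j \<in> X \<Longrightarrow> cinner (b i) (b j) = cinner (a i) (a j)"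
begin

lemma gram_rel_cinner:
  assumes "gram_rel X a b x y" and "gram_rel X a b x' y'"
  shows "cinner y y' = cinner x x'"
  using assms(2)
proof (induction)
  case (base j)
  from assms(1) show ?case
  proof (induction)
    case (lim f g x y)
    then show ?case
      using tendsto_cinner[OF lim(2) tendsto_const, of "a j"] tendsto_cinner[OF lim(3) tendsto_const, of "b j"]
      by (simp add: LIMSEQ_unique)
  qed (simp_all add: gram base cinner_add_left cinner_scaleC_left)
next
  case (lim f g x' y')
  then show ?case
    using tendsto_cinner[OF tendsto_const lim(2), of x] tendsto_cinner[OF tendsto_const lim(3), of y]
    by (simp add: LIMSEQ_unique)
qed (simp_all add: cinner_add_right cinner_scaleC_right)

lemma gram_rel_norm_diff:
  assumes "gram_rel X a b x y" and "gram_rel X a b x' y'"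
  shows "norm (y - y') = norm (x - x')"
proof -
  have "gram_rel X a b (x + (-1) *\<^sub>C x') (y + (-1) *\<^sub>C y')"
    by (intro gram_rel.add gram_rel.scale assms)
  then have "gram_rel X a b (x - x') (y - y')"
    by simp
  then have "cinner (y - y') (y - y') = cinner (x - x') (x - x')"
    using gram_rel_cinner by blast
  then show ?thesis
    by (simp add: cinner_self power2_eq_iff_nonneg flip: of_real_power)
qed

lemma gram_rel_unique: "gram_rel X a b x y \<Longrightarrow> gram_rel X a b x y' \<Longrightarrow> y = y'"
  using gram_rel_norm_diff[of x y x y'] by simp

text \<open>
  If \<open>f k\<close> converges, its partners \<open>g k\<close> form a Cauchy sequence, since the relation preserves
  distances; completeness of the target supplies the limit.
\<close>

lemma gram_rel_domain:
  assumes "x \<in> closure (complex_vector.span (a ` X))"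
  shows "\<exists>y. gram_rel X a b x y"
  using assms
proof (induction rule: closure_span_induct)
  case (lim f x)
  then obtain g where g: "\<And>k. gram_rel X a b (f k) (g k)"
    by metis
  have "Cauchy f"
    using lim(2) LIMSEQ_imp_Cauchy by blast
  then have "Cauchy g"
    unfolding Cauchy_def dist_norm using gram_rel_norm_diff[OF g g] by simp
  then obtain y where "g \<longlonglongrightarrow> y"
    using Cauchy_convergent convergent_def by blast
  then show ?case
    using gram_rel.lim[OF g lim(2)] by blast
qed (auto intro: gram_rel.intros)

lemma isometry_of_gram:
  assumes "closure (complex_vector.span (a ` X)) = UNIV"
  obtains E where "isometry E" "\<And>i. i \<in> X \<Longrightarrow> E (a i) = b i"
proof -
  obtain E where E: "\<And>x. gram_rel X a b x (E x)"
    using gram_rel_domain assms by (metis UNIV_I)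
  show thesis
  proof (rule that)
    show "isometry E"
    proof (rule isometryI)
      show "norm (E x) = norm x" for x
        using gram_rel_norm_diff[OF E[of x] gram_rel.zero] by simp
    qed (meson E gram_rel_unique gram_rel.add gram_rel.scale)+
  qed (meson E gram_rel_unique gram_rel.base)
qed

end

section \<open>Monomials in commuting operators\<close>

lemma comm_funpow:
  assumes comm: "A \<circ> B = B \<circ> A"
  shows "A ^^ k \<circ> B ^^ l = B ^^ l \<circ> A ^^ k"
proof -
  have A: "A (B x) = B (A x)" for x
    using comm by (simp add: fun_eq_iff)
  have Ak: "(A ^^ k) (B x) = B ((A ^^ k) x)" for x
    by (induction k) (simp_all add: A)
  have "(A ^^ k) ((B ^^ l) x) = (B ^^ l) ((A ^^ k) x)" for x
    by (induction l) (simp_all add: Ak)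
  then show ?thesis
    by (simp add: fun_eq_iff)
qed

lemma comm_op_prod:
  assumes "\<And>i. i \<in> {1..n} \<Longrightarrow> A i \<circ> B = B \<circ> A i"
  shows "op_prod A n \<circ> B = B \<circ> op_prod A n"
  using assms
proof (induction n)
  case (Suc n)
  have "A (Suc n) (B x) = B (A (Suc n) x)" for x
    using Suc.prems[of "Suc n"] by (simp add: fun_eq_iff)
  moreover have "op_prod A n (B x) = B (op_prod A n x)" for x
    using Suc.IH Suc.prems by (simp add: fun_eq_iff)
  ultimately show ?case
    by (simp add: fun_eq_iff)
qed simp

lemma op_prod_cong:
  "(\<And>i. i \<in> {1..n} \<Longrightarrow> A i = B i) \<Longrightarrow> op_prod A n = op_prod B n"
  by (induction n) auto

lemma op_monomial_cong:
  "(\<And>i. i \<in> {1..n} \<Longrightarrow> A i = B i) \<Longrightarrow> (\<And>i. i \<in> {1..n} \<Longrightarrow> k i = l i) \<Longrightarrow>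
    op_monomial n A k = op_monomial n B l"
  unfolding op_monomial_def by (rule op_prod_cong) auto

lemma op_monomial_Suc:
  "op_monomial (Suc n) A k = op_monomial n A k \<circ> A (Suc n) ^^ k (Suc n)"
  by (simp add: op_monomial_def)

lemma commuting_Suc: "commuting (Suc n) A \<Longrightarrow> commuting n A"
  by (auto simp: commuting_def)

lemma op_monomial_comm:
  assumes "commuting (Suc n) A"
  shows "op_monomial n A k \<circ> A (Suc n) ^^ l = A (Suc n) ^^ l \<circ> op_monomial n A k"
  unfolding op_monomial_def
  using assms by (intro comm_op_prod comm_funpow) (auto simp: commuting_def)

lemma op_monomial_add:
  assumes "commuting n A"
  shows "op_monomial n A (\<lambda>i. k i + l i) = op_monomial n A k \<circ> op_monomial n A l"
  using assms
proof (induction n)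
  case 0
  then show ?case
    by (simp add: op_monomial_def)
next
  case (Suc n)
  show ?case
    using Suc.IH[OF commuting_Suc[OF Suc.prems]] op_monomial_comm[OF Suc.prems, of l "k (Suc n)"]
    by (simp add: op_monomial_Suc funpow_add fun_eq_iff)
qed

lemma op_monomial_add_apply:
  "commuting n A \<Longrightarrow> op_monomial n A k (op_monomial n A l x) = op_monomial n A (\<lambda>i. k i + l i) x"
  by (simp add: op_monomial_add)

lemma op_monomial_0: "op_monomial n A (\<lambda>_. 0) = id"
  unfolding op_monomial_def by (induction n) auto

lemma op_monomial_const:
  assumes "commuting n A"
  shows "op_monomial n A (\<lambda>_. m) = op_prod A n ^^ m"
proof (induction m)
  case (Suc m)
  have "op_monomial n A (\<lambda>_. Suc m) = op_monomial n A (\<lambda>_. 1) \<circ> op_monomial n A (\<lambda>_. m)"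
    using op_monomial_add[OF assms, of "\<lambda>_. 1" "\<lambda>_. m"] by simp
  also have "op_monomial n A (\<lambda>_. 1) = op_prod A n"
    by (simp add: op_monomial_def)
  finally show ?case
    using Suc by simp
qed (simp add: op_monomial_0)

lemma isometry_op_monomial:
  "(\<And>i. i \<in> {1..n} \<Longrightarrow> isometry (A i)) \<Longrightarrow> isometry (op_monomial n A k)"
  unfolding op_monomial_def by (intro isometry_op_prod isometry_funpow)

lemma adjoint_funpow:
  fixes A B :: "'a::complex_inner \<Rightarrow> 'a"
  assumes "\<And>x y. cinner (A x) y = cinner x (B y)"
  shows "cinner ((A ^^ k) x) y = cinner x ((B ^^ k) y)"
  by (induction k arbitrary: x y) (simp_all add: assms funpow_swap1)

lemma commuting_adjoint:
  fixes A B :: "nat \<Rightarrow> 'a::complex_inner \<Rightarrow> 'a"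
  assumes adj: "\<And>i x y. i \<in> {1..n} \<Longrightarrow> cinner (A i x) y = cinner x (B i y)"
    and comm: "commuting n A"
  shows "commuting n B"
  unfolding commuting_def
proof (intro ballI ext)
  fix i j y assume ij: "i \<in> {1..n}" "j \<in> {1..n}"
  have eq: "cinner x (B i (B j y)) = cinner x (B j (B i y))" for x
  proof -
    have "A i (A j x) = A j (A i x)"
      using comm ij by (auto simp: commuting_def fun_eq_iff)
    then show ?thesis
      using ij by (simp add: adj[symmetric])
  qed
  have "cinner (B i (B j y) - B j (B i y)) (B i (B j y) - B j (B i y)) = 0"
    unfolding cinner_diff_right eq by simp
  then show "(B i \<circ> B j) y = (B j \<circ> B i) y"
    by (simp add: cinner_self_eq_0_iff)
qed

text \<open>
  Adjoints reverse the order of the factors; commutativity restores it.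
\<close>

lemma adjoint_op_monomial:
  fixes A B :: "nat \<Rightarrow> 'a::complex_inner \<Rightarrow> 'a"
  assumes "\<And>i x y. i \<in> {1..n} \<Longrightarrow> cinner (A i x) y = cinner x (B i y)"
    and "commuting n A"
  shows "cinner (op_monomial n A k x) y = cinner x (op_monomial n B k y)"
  using assms
proof (induction n arbitrary: x y)
  case (Suc n)
  have B: "commuting (Suc n) B"
    by (rule commuting_adjoint[OF Suc.prems])
  have "cinner (op_monomial (Suc n) A k x) y
      = cinner ((A (Suc n) ^^ k (Suc n)) x) (op_monomial n B k y)"
    using Suc.IH Suc.prems(1) commuting_Suc[OF Suc.prems(2)] by (simp add: op_monomial_Suc)
  also have "\<dots> = cinner x ((B (Suc n) ^^ k (Suc n)) (op_monomial n B k y))"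
    using Suc.prems(1) by (intro adjoint_funpow) auto
  also have "\<dots> = cinner x (op_monomial (Suc n) B k y)"
    using op_monomial_comm[OF B, of k "k (Suc n)"] by (simp add: op_monomial_Suc fun_eq_iff)
  finally show ?case .
qed (simp add: op_monomial_def)

section \<open>Dilations in terms of inner products\<close>

text \<open>
  The projection onto the range of \<open>J\<close> is \<open>J\<close> composed with its adjoint.
\<close>

lemma orth_proj_range_iff:
  fixes J :: "'h::chilbert_space \<Rightarrow> 'k::chilbert_space"
  assumes J: "isometry J"
  shows "J x = orth_proj (range J) w \<longleftrightarrow> (\<forall>h. cinner w (J h) = cinner x h)"
proof -
  obtain u where "\<And>h. cinner (J h) w = cinner h u"
    using adjoint_vector_exists[OF isometry_clinear(5)[OF J]] by blast
  then have u: "cinner w (J h) = cinner u h" for h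
    by (metis cinner_commute)
  have orth: "(\<forall>z\<in>range J. cinner (w - J v) z = 0) \<longleftrightarrow> v = u" for v
  proof
    assume "\<forall>z\<in>range J. cinner (w - J v) z = 0"
    then have "cinner u h = cinner v h" for h
      by (auto simp: cinner_diff_left u isometry_cinner[OF J])
    then have "cinner (v - u) (v - u) = 0"
      by (simp add: cinner_diff_left)
    then show "v = u"
      by (simp add: cinner_self_eq_0_iff)
  qed (auto simp: cinner_diff_left u isometry_cinner[OF J])
  have inj: "J x = J v \<longleftrightarrow> x = v" for x v
  proof
    assume "J x = J v"
    then have "cinner (x - v) h = 0" for h
      by (metis cinner_diff_left isometry_cinner[OF J] right_minus_eq)
    then show "x = v"
      using cinner_self_eq_0_iff[of "x - v"] by simp
  qed simp
  have "orth_proj (range J) w = J u"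
    unfolding orth_proj_def using orth by (intro the_equality) auto
  then have "J x = orth_proj (range J) w \<longleftrightarrow> x = u"
    by (simp add: inj)
  also have "\<dots> \<longleftrightarrow> (\<forall>h. cinner w (J h) = cinner x h)"
    using u orth[of x] by (auto simp: cinner_diff_left isometry_cinner[OF J])
  finally show ?thesis .
qed

lemma isometric_dilation_iff:
  "isometric_dilation n J V T \<longleftrightarrow>
    isometry J \<and> (\<forall>i\<in>{1..n}. isometry (V i)) \<and> commuting n V \<and>
    (\<forall>k h h'. cinner (op_monomial n V k (J h)) (J h') = cinner (op_monomial n T k h) h')"
  unfolding isometric_dilation_def using orth_proj_range_iff by blast

lemma op_monomial_1: "op_monomial 1 (\<lambda>_. A) k = A ^^ k 1"
  by (simp add: op_monomial_def)

lemma minimal_isometric_dilation1_iff: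
  "minimal_isometric_dilation1 J V T \<longleftrightarrow>
    isometry J \<and> isometry V \<and>
    (\<forall>m h h'. cinner ((V ^^ m) (J h)) (J h') = cinner ((T ^^ m) h) h') \<and>
    closure (complex_vector.span {(V ^^ m) (J h) | m h. True}) = UNIV"
proof -
  have all: "(\<forall>k :: nat \<Rightarrow> nat. P (k 1)) \<longleftrightarrow> (\<forall>m. P m)" for P
    using spec[of "\<lambda>k. P (k 1)" "\<lambda>_. m" for m] by blast
  have "(\<exists>(k :: nat \<Rightarrow> nat) h. x = (V ^^ k 1) (J h) \<and> True) \<longleftrightarrow> (\<exists>m h. x = (V ^^ m) (J h) \<and> True)"
    for x
    using all[of "\<lambda>m. \<forall>h. x \<noteq> (V ^^ m) (J h)"] by auto
  then have span: "{(V ^^ k 1) (J h) | (k :: nat \<Rightarrow> nat) h. True} = {(V ^^ m) (J h) | m h. True}"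
    by (rule Collect_cong)
  have dil: "(\<forall>(k :: nat \<Rightarrow> nat) h h'. cinner ((V ^^ k 1) (J h)) (J h') = cinner ((T ^^ k 1) h) h')
      \<longleftrightarrow> (\<forall>m h h'. cinner ((V ^^ m) (J h)) (J h') = cinner ((T ^^ m) h) h')"
    by (rule all)
  show ?thesis
    unfolding minimal_isometric_dilation1_def minimal_isometric_dilation_def
      isometric_dilation_iff op_monomial_1 span dil
    by (simp add: commuting_def)
qed

section \<open>Monomials of the dilation on the initial space\<close>

text \<open>
  The tuples enter through the adjoint relation alone, which is symmetric, so that the locale can be
  used with \<open>T\<close> and \<open>S\<close> exchanged.  The dilation \<open>V\<close> is a tuple, whereas for \<open>S\<close> only a dilation of the product
  is given; the task is to factorise \<open>Y0\<close>.
\<close>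

locale dual_dilations =
  fixes n :: nat and T S :: "nat \<Rightarrow> 'h::chilbert_space \<Rightarrow> 'h"
    and J :: "'h \<Rightarrow> 'k::chilbert_space" and V :: "nat \<Rightarrow> 'k \<Rightarrow> 'k"
    and L :: "'h \<Rightarrow> 'l::chilbert_space" and Y0 :: "'l \<Rightarrow> 'l"
  assumes adj: "\<And>i x y. i \<in> {1..n} \<Longrightarrow> cinner (T i x) y = cinner x (S i y)"
    and comm_T: "commuting n T"
    and dil: "isometric_dilation n J V T"
    and min_V: "minimal_isometric_dilation1 J (op_prod V n) (op_prod T n)"
    and min_Y: "minimal_isometric_dilation1 L Y0 (op_prod S n)"
begin

abbreviation "mV \<equiv> op_monomial n V"
abbreviation "mT \<equiv> op_monomial n T"
abbreviation "mS \<equiv> op_monomial n S"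

lemma comm_S: "commuting n S"
  by (rule commuting_adjoint[OF adj comm_T])

lemma isometries: "isometry J" "\<And>i. i \<in> {1..n} \<Longrightarrow> isometry (V i)" "commuting n V"
    "isometry L" "isometry Y0"
  using dil min_Y by (auto simp: isometric_dilation_iff minimal_isometric_dilation1_iff)

lemma isometry_mV: "isometry (mV k)"
  by (intro isometry_op_monomial isometries)

lemma mV_add: "mV k (mV l x) = mV (\<lambda>i. k i + l i) x"
  by (rule op_monomial_add_apply[OF isometries(3)])

lemma mV_cancel: "cinner (mV (\<lambda>i. r i + p i) x) (mV (\<lambda>i. r i + q i) y) = cinner (mV p x) (mV q y)"
  by (simp add: mV_add[symmetric] isometry_cinner[OF isometry_mV])

lemma mV_cong: "(\<And>i. i \<in> {1..n} \<Longrightarrow> k i = l i) \<Longrightarrow> mV k = mV l"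
  by (rule op_monomial_cong) auto

lemma mV_0: "mV (\<lambda>_. 0) x = x"
  by (simp add: op_monomial_0)

lemma mT_add: "mT k (mT l x) = mT (\<lambda>i. k i + l i) x"
  by (rule op_monomial_add_apply[OF comm_T])

lemma mT_adj: "cinner (mT k x) y = cinner x (mS k y)"
  by (rule adjoint_op_monomial[OF adj comm_T])

lemma mS_adj: "cinner (mS k x) y = cinner x (mT k y)"
  by (rule cinner_flip) (rule mT_adj[symmetric])

lemma dil_cinner: "cinner (J x) (mV k (J y)) = cinner x (mT k y)"
proof -
  have "cinner (mV k (J y)) (J x) = cinner (mT k y) x"
    using dil by (simp add: isometric_dilation_iff)
  then show ?thesis
    by (rule cinner_flip)
qed

lemma total_V: "closure (complex_vector.span {mV (\<lambda>_. j) (J h) | j h. True}) = UNIV"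
  using min_V by (simp add: minimal_isometric_dilation1_iff op_monomial_const[OF isometries(3)])

lemma total_Y: "closure (complex_vector.span {(Y0 ^^ j) (L h) | j h. True}) = UNIV"
  using min_Y by (simp add: minimal_isometric_dilation1_iff)

text \<open>
  The adjoint of \<open>mV q\<close> maps \<open>J h\<close> to \<open>J (mS q h)\<close>.  By minimality it is enough to test this against
  the vectors \<open>mV (\<lambda>_. j) (J h')\<close>, where both sides are matrix coefficients of monomials in \<open>T\<close>.
\<close>

lemma J_coinvariant: "cinner (J h) (mV q z) = cinner (J (mS q h)) z"
proof -
  have "z \<in> closure (complex_vector.span {mV (\<lambda>_. j) (J h) | j h. True})"
    unfolding total_V by (rule UNIV_I)
  then show ?thesis
  proof (induction rule: closure_span_induct)
    case (base z)
    then obtain j h' where z: "z = mV (\<lambda>_. j) (J h')"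
      by blast
    show ?case
      by (simp add: z mV_add dil_cinner mS_adj mT_add)
  next
    case (lim f z)
    then show ?case
      using tendsto_cinner[OF tendsto_const bounded_clinear_tendsto[OF isometry_clinear(5)[OF isometry_mV] lim(2)], of "J h" q]
        tendsto_cinner[OF tendsto_const lim(2), of "J (mS q h)"]
      by (simp add: LIMSEQ_unique)
  qed (simp_all add: isometry_clinear[OF isometry_mV] cinner_add_right cinner_scaleC_right)
qed

abbreviation initial_vectors :: "nat \<Rightarrow> 'k set" where
  "initial_vectors m \<equiv> {mV (\<lambda>_. j) (J h) | j h. j \<le> m}"

text \<open>
  With \<open>W = op_prod V n ^^ m\<close> and \<open>z\<close> the image of \<open>y\<close> under the adjoint of \<open>W\<close>, the vector \<open>W z\<close> is
  the projection of \<open>y\<close> onto the range of \<open>W\<close>.  To see that it is \<open>y\<close>, compare inner products with the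
  total set: for exponents above \<open>m\<close> the test vector is in the range of \<open>W\<close>, and for the others both
  inner products vanish by coinvariance.
\<close>

lemma orthogonal_initial_vectors:
  assumes y: "\<And>s. s \<in> initial_vectors m \<Longrightarrow> cinner s y = 0"
  obtains z where "y = mV (\<lambda>_. m) z" "\<And>h. cinner (J h) z = 0"
proof -
  have y': "cinner y (mV (\<lambda>_. j) (J h)) = 0" if "j \<le> m" for j h
    using y[of "mV (\<lambda>_. j) (J h)"] that cinner_commute[of y] by auto
  obtain z where z: "\<And>x. cinner (mV (\<lambda>_. m) x) y = cinner x z"
    using adjoint_vector_exists[OF isometry_clinear(5)[OF isometry_mV]] by blast
  then have z': "cinner y (mV (\<lambda>_. m) x) = cinner z x" for x
    by (rule cinner_flip)
  have Jz: "cinner (J h) z = 0" for h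
    using y[of "mV (\<lambda>_. m) (J h)"] unfolding z by blast
  have "y = mV (\<lambda>_. m) z"
  proof (rule total_cinner_eqI[OF total_V], clarify)
    fix j h
    show "cinner y (mV (\<lambda>_. j) (J h)) = cinner (mV (\<lambda>_. m) z) (mV (\<lambda>_. j) (J h))"
    proof (cases "j \<le> m")
      case True
      have "mV (\<lambda>_. m) z = mV (\<lambda>_. j) (mV (\<lambda>_. m - j) z)"
        using True by (simp add: mV_add)
      then have "cinner (mV (\<lambda>_. j) (J h)) (mV (\<lambda>_. m) z) = cinner (J h) (mV (\<lambda>_. m - j) z)"
        by (simp add: isometry_cinner[OF isometry_mV])
      also have "\<dots> = 0"
        by (simp add: J_coinvariant Jz)
      finally show ?thesis
        using y'[OF True, of h] cinner_commute[of "mV (\<lambda>_. m) z"] by simp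
    next
      case False
      then have "mV (\<lambda>_. j) (J h) = mV (\<lambda>_. m) (mV (\<lambda>_. j - m) (J h))"
        by (simp add: mV_add)
      then show ?thesis
        by (simp add: isometry_cinner[OF isometry_mV] z')
    qed
  qed
  then show thesis
    using Jz that by blast
qed

text \<open>
  This is where the individual \<open>V\<^sub>i\<close> are controlled by their product.  A vector \<open>y\<close> orthogonal to
  the initial vectors has the form \<open>mV (\<lambda>_. m) z\<close> with \<open>z\<close> orthogonal to the range of \<open>J\<close>.  Applying the
  isometry \<open>mV q\<close> to both arguments turns \<open>mV k\<close> into \<open>mV (\<lambda>_. m)\<close>, which cancels, and leaves the
  inner product of \<open>J h\<close> with \<open>mV q z\<close>; this vanishes by coinvariance.
\<close>

lemma monomial_in_initial_space:
  assumes kq: "\<And>i. i \<in> {1..n} \<Longrightarrow> k i + q i = m"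
  shows "mV k (J h) \<in> closure (complex_vector.span (initial_vectors m))"
proof (rule mem_closure_spanI)
  fix y assume y: "\<And>s. s \<in> initial_vectors m \<Longrightarrow> cinner s y = 0"
  obtain z where z: "y = mV (\<lambda>_. m) z" "\<And>h. cinner (J h) z = 0"
    by (rule orthogonal_initial_vectors[of m y], erule y, rule that)
  have qk: "mV (\<lambda>i. q i + k i) = mV (\<lambda>_. m)"
    by (rule mV_cong) (metis add.commute kq)
  have "cinner (mV k (J h)) y = cinner (mV q (mV k (J h))) (mV q (mV (\<lambda>_. m) z))"
    unfolding z(1) isometry_cinner[OF isometry_mV] by (rule refl)
  also have "\<dots> = cinner (mV (\<lambda>_. m) (J h)) (mV (\<lambda>_. m) (mV q z))"
    unfolding mV_add[of q k] qk by (simp add: mV_add add.commute)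
  also have "\<dots> = cinner (J (mS q h)) z"
    unfolding isometry_cinner[OF isometry_mV] by (rule J_coinvariant)
  finally show "cinner (mV k (J h)) y = 0"
    by (simp add: z(2))
qed

section \<open>Negative powers inside the dual dilation space\<close>

lemma dil_Y: "cinner ((Y0 ^^ j) (L x)) (L y) = cinner x (mT (\<lambda>_. j) y)"
  using min_Y
  by (simp add: minimal_isometric_dilation1_iff op_monomial_const[OF comm_S, symmetric] mS_adj)

lemma gram_Y_le:
  assumes "b \<le> a"
  shows "cinner ((Y0 ^^ a) (L x)) ((Y0 ^^ b) (L y)) = cinner (mV (\<lambda>_. b) (J x)) (mV (\<lambda>_. a) (J y))"
proof -
  obtain c where c: "a = b + c"
    using assms le_Suc_ex by blast
  have "cinner ((Y0 ^^ a) (L x)) ((Y0 ^^ b) (L y)) = cinner x (mT (\<lambda>_. c) y)"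
    by (simp add: c funpow_add isometry_cinner[OF isometry_funpow[OF isometries(5)]] dil_Y)
  also have "\<dots> = cinner (mV (\<lambda>_. b) (J x)) (mV (\<lambda>_. a) (J y))"
    by (simp add: c mV_add[symmetric] isometry_cinner[OF isometry_mV] dil_cinner)
  finally show ?thesis .
qed

text \<open>
  In terms of the unitary extension \<open>U\<close> of \<open>V\<close>: the inner product of \<open>U\<^sup>-\<^sup>a x\<close> and \<open>U\<^sup>-\<^sup>b y\<close> does not
  change when \<open>U\<^sup>a\<^sup>+\<^sup>b\<close> is applied to both.
\<close>

lemma gram_Y:
  "cinner ((Y0 ^^ a) (L x)) ((Y0 ^^ b) (L y)) = cinner (mV (\<lambda>_. b) (J x)) (mV (\<lambda>_. a) (J y))"
proof (cases "b \<le> a")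
  case False
  then have "a \<le> b"
    by simp
  then show ?thesis
    by (rule cinner_flip[OF gram_Y_le])
qed (rule gram_Y_le)

text \<open>
  The graph of \<open>U\<^sup>-\<^sup>m\<close> on the closed span of \<open>initial_vectors m\<close>, on which \<open>U\<^sup>-\<^sup>m\<close> takes values in the
  dual dilation space.
\<close>

definition shift_rel :: "nat \<Rightarrow> 'k \<Rightarrow> 'l \<Rightarrow> bool" where
  "shift_rel m = gram_rel ({..m} \<times> UNIV) (\<lambda>(j, h). mV (\<lambda>_. j) (J h)) (\<lambda>(j, h). (Y0 ^^ (m - j)) (L h))"

lemma shift_rel_gram:
  assumes "i \<in> {..m} \<times> UNIV" and "j \<in> {..m} \<times> UNIV"
  shows "cinner ((\<lambda>(j, h). (Y0 ^^ (m - j)) (L h)) i) ((\<lambda>(j, h). (Y0 ^^ (m - j)) (L h)) j)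
    = cinner ((\<lambda>(j, h). mV (\<lambda>_. j) (J h)) i) ((\<lambda>(j, h). mV (\<lambda>_. j) (J h)) j)"
proof -
  obtain a x b y where ab: "i = (a, x)" "j = (b, y)" "a \<le> m" "b \<le> m"
    using assms by auto
  have "cinner ((Y0 ^^ (m - a)) (L x)) ((Y0 ^^ (m - b)) (L y))
      = cinner (mV (\<lambda>_. (a + b) + (m - b)) (J x)) (mV (\<lambda>_. (a + b) + (m - a)) (J y))"
    unfolding gram_Y by (rule mV_cancel[symmetric])
  also have "\<dots> = cinner (mV (\<lambda>_. m + a) (J x)) (mV (\<lambda>_. m + b) (J y))"
    using ab by (simp add: add.commute)
  also have "\<dots> = cinner (mV (\<lambda>_. a) (J x)) (mV (\<lambda>_. b) (J y))"
    by (rule mV_cancel)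
  finally show ?thesis
    by (simp add: ab)
qed

lemma shift_rel_cinner:
  "shift_rel m x y \<Longrightarrow> shift_rel m x' y' \<Longrightarrow> cinner y y' = cinner x x'"
  unfolding shift_rel_def by (rule gram_rel_cinner[OF shift_rel_gram])

lemma shift_rel_domain:
  assumes "x \<in> closure (complex_vector.span (initial_vectors m))"
  shows "\<exists>y. shift_rel m x y"
proof -
  have "initial_vectors m = (\<lambda>(j, h). mV (\<lambda>_. j) (J h)) ` ({..m} \<times> UNIV)"
    by auto
  then show ?thesis
    unfolding shift_rel_def using assms by (intro gram_rel_domain[OF shift_rel_gram]) simp_all
qed

lemma shift_rel_cinner_Y:
  assumes "shift_rel m x y"
  shows "cinner y ((Y0 ^^ j) (L h)) = cinner (mV (\<lambda>_. j) x) (mV (\<lambda>_. m) (J h))"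
  using assms unfolding shift_rel_def
proof (induction)
  case (base i)
  then obtain a h' where a: "i = (a, h')" "a \<le> m"
    by auto
  have "cinner ((Y0 ^^ (m - a)) (L h')) ((Y0 ^^ j) (L h))
      = cinner (mV (\<lambda>_. a + j) (J h')) (mV (\<lambda>_. a + (m - a)) (J h))"
    unfolding gram_Y by (rule mV_cancel[symmetric])
  also have "\<dots> = cinner (mV (\<lambda>_. j) (mV (\<lambda>_. a) (J h'))) (mV (\<lambda>_. m) (J h))"
    using a(2) by (simp add: mV_add add.commute)
  finally show ?case
    by (simp add: a(1))
next
  case (lim f g x y)
  then show ?case
    using tendsto_cinner[OF lim(3) tendsto_const, of "(Y0 ^^ j) (L h)"]
      tendsto_cinner[OF bounded_clinear_tendsto[OF isometry_clinear(5)[OF isometry_mV] lim(2)] tendsto_const, of "\<lambda>_. j" "mV (\<lambda>_. m) (J h)"]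
    by (simp add: LIMSEQ_unique)
qed (simp_all add: isometry_clinear[OF isometry_mV] cinner_add_left cinner_scaleC_left)

text \<open>
  The vector \<open>U\<^sup>-\<^sup>p h\<close>, described by its inner products with the total set of vectors
  \<open>(Y0 ^^ j) (L h')\<close>.  That such a vector exists is part of \<open>shift_rel_neg_monomial\<close> below.
\<close>

definition neg_monomial :: "(nat \<Rightarrow> nat) \<Rightarrow> 'h \<Rightarrow> 'l" where
  "neg_monomial p h =
    (THE d. \<forall>j h'. cinner d ((Y0 ^^ j) (L h')) = cinner (mV (\<lambda>_. j) (J h)) (mV p (J h')))"

lemma neg_monomial_eqI:
  assumes "\<And>j h'. cinner d ((Y0 ^^ j) (L h')) = cinner (mV (\<lambda>_. j) (J h)) (mV p (J h'))"
  shows "neg_monomial p h = d"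
  unfolding neg_monomial_def
proof (rule the_equality)
  fix e assume "\<forall>j h'. cinner e ((Y0 ^^ j) (L h')) = cinner (mV (\<lambda>_. j) (J h)) (mV p (J h'))"
  then have eq: "cinner e ((Y0 ^^ j) (L h')) = cinner d ((Y0 ^^ j) (L h'))" for j h'
    by (simp add: assms)
  show "e = d"
    by (rule total_cinner_eqI[OF total_Y]) (elim CollectE exE, simp add: eq)
qed (simp add: assms)

text \<open>
  \<open>U\<^sup>-\<^sup>p h\<close> arises by applying \<open>U\<^sup>-\<^sup>m\<close> to a monomial with nonnegative exponents as soon as \<open>m\<close>
  bounds \<open>p\<close>.  The vector so obtained has the inner products that define \<open>neg_monomial p h\<close>, and these
  do not depend on \<open>m\<close>.
\<close>

lemma shift_rel_neg_monomial:
  assumes "\<And>i. i \<in> {1..n} \<Longrightarrow> p i \<le> m"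
  shows "shift_rel m (mV (\<lambda>i. m - p i) (J h)) (neg_monomial p h)"
proof -
  have m: "mV (\<lambda>i. m - p i) (mV p x) = mV (\<lambda>_. m) x" for x
    unfolding mV_add using assms by (subst mV_cong[where l = "\<lambda>_. m"]) auto
  have "mV (\<lambda>i. m - p i) (J h) \<in> closure (complex_vector.span (initial_vectors m))"
    by (rule monomial_in_initial_space[where q = p]) (use assms in simp)
  then obtain d where d: "shift_rel m (mV (\<lambda>i. m - p i) (J h)) d"
    using shift_rel_domain by blast
  have "neg_monomial p h = d"
  proof (rule neg_monomial_eqI)
    fix j h'
    have "cinner d ((Y0 ^^ j) (L h'))
        = cinner (mV (\<lambda>_. j) (mV (\<lambda>i. m - p i) (J h))) (mV (\<lambda>i. m - p i) (mV p (J h')))"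
      by (simp add: shift_rel_cinner_Y[OF d] m)
    also have "\<dots> = cinner (mV (\<lambda>i. (m - p i) + j) (J h)) (mV (\<lambda>i. (m - p i) + p i) (J h'))"
      by (simp only: mV_add add.commute[of j])
    also have "\<dots> = cinner (mV (\<lambda>_. j) (J h)) (mV p (J h'))"
      by (rule mV_cancel)
    finally show "cinner d ((Y0 ^^ j) (L h')) = cinner (mV (\<lambda>_. j) (J h)) (mV p (J h'))" .
  qed
  then show ?thesis
    using d by simp
qed

text \<open>
  Take \<open>m\<close> so large that both vectors are images under the same \<open>U\<^sup>-\<^sup>m\<close>, which preserves inner
  products; then multiply both arguments by \<open>mV (\<lambda>i. p i + q i)\<close> to remove the differences
  \<open>m - p i\<close> and \<open>m - q i\<close>, and cancel \<open>m\<close>.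
\<close>

lemma neg_monomial_cinner:
  "cinner (neg_monomial p x) (neg_monomial q y) = cinner (mV q (J x)) (mV p (J y))"
proof -
  define m where "m = (\<Sum>i\<in>{1..n}. p i + q i)"
  have le: "p i + q i \<le> m" if "i \<in> {1..n}" for i
    unfolding m_def using that by (intro member_le_sum) auto
  have "cinner (neg_monomial p x) (neg_monomial q y)
      = cinner (mV (\<lambda>i. m - p i) (J x)) (mV (\<lambda>i. m - q i) (J y))"
    using le by (intro shift_rel_cinner[of m] shift_rel_neg_monomial) (auto dest: add_leD1 add_leD2)
  also have "\<dots> = cinner (mV (\<lambda>i. (p i + q i) + (m - p i)) (J x)) (mV (\<lambda>i. (p i + q i) + (m - q i)) (J y))"
    by (rule mV_cancel[symmetric])
  also have "mV (\<lambda>i. (p i + q i) + (m - p i)) = mV (\<lambda>i. m + q i)"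
    by (rule mV_cong) (use le in force)
  also have "mV (\<lambda>i. (p i + q i) + (m - q i)) = mV (\<lambda>i. m + p i)"
    by (rule mV_cong) (use le in force)
  also have "cinner (mV (\<lambda>i. m + q i) (J x)) (mV (\<lambda>i. m + p i) (J y)) = cinner (mV q (J x)) (mV p (J y))"
    by (rule mV_cancel)
  finally show ?thesis .
qed

lemma neg_monomial_const: "neg_monomial (\<lambda>_. j) h = (Y0 ^^ j) (L h)"
  by (rule neg_monomial_eqI) (rule gram_Y)

lemma neg_monomial_cong:
  "(\<And>i. i \<in> {1..n} \<Longrightarrow> p i = q i) \<Longrightarrow> neg_monomial p = neg_monomial q"
  unfolding neg_monomial_def using mV_cong[of p q] by simp

section \<open>The dual dilation\<close>

text \<open>
  By \<open>neg_monomial_cinner\<close>, raising the \<open>i\<close>-th exponent of both arguments applies \<open>V i\<close> to both sides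
  of the inner product, so the Gram matrix does not change.
\<close>

lemma neg_monomial_shift:
  "\<exists>E. isometry E \<and> (\<forall>p h. E (neg_monomial p h) = neg_monomial (p(i := Suc (p i))) h)"
proof -
  let ?a = "\<lambda>(p, h). neg_monomial p h"
  let ?b = "\<lambda>(p, h). neg_monomial (p(i := Suc (p i))) h"
  let ?e = "\<lambda>j. if j = i then 1 else 0"
  have upd: "p(i := Suc (p i)) = (\<lambda>j. ?e j + p j)" for p :: "nat \<Rightarrow> nat"
    by auto
  have gram: "cinner (?b u) (?b v) = cinner (?a u) (?a v)" for u v
    by (simp add: split_beta neg_monomial_cinner upd mV_cancel)
  have "{(Y0 ^^ j) (L h) | j h. True} \<subseteq> range ?a"
  proof clarify
    fix j h
    have "?a (\<lambda>_. j, h) = (Y0 ^^ j) (L h)"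
      by (simp add: neg_monomial_const)
    then show "(Y0 ^^ j) (L h) \<in> range ?a"
      using rangeI[of ?a "(\<lambda>_. j, h)"] by simp
  qed
  from closure_mono[OF complex_vector.span_mono[OF this]]
  have "closure (complex_vector.span (range ?a)) = UNIV"
    unfolding total_Y by (rule top.extremum_uniqueI)
  then obtain E where E: "isometry E" "\<And>u. u \<in> UNIV \<Longrightarrow> E (?a u) = ?b u"
    by (rule isometry_of_gram[of UNIV ?b ?a, OF gram]) (rule that)
  show ?thesis
    using E(1) E(2)[OF UNIV_I, of "(p, h)" for p h] by auto
qed

text \<open>
  The isometries \<open>Y i\<close> act on the total set of vectors \<open>neg_monomial p h\<close> by adding to exponents.
  Hence they commute, and their product raises every exponent by \<open>1\<close>, as \<open>Y0\<close> does on the total set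
  of vectors \<open>neg_monomial (\<lambda>_. j) h\<close>.
\<close>

lemma dual_dilation_exists:
  "\<exists>Y. isometric_dilation n L Y S \<and> op_prod Y n = Y0"
proof -
  have "\<forall>i. \<exists>E. isometry E \<and> (\<forall>p h. E (neg_monomial p h) = neg_monomial (p(i := Suc (p i))) h)"
    by (intro allI neg_monomial_shift)
  then obtain Y where "\<forall>i. isometry (Y i) \<and>
      (\<forall>p h. Y i (neg_monomial p h) = neg_monomial (p(i := Suc (p i))) h)"
    unfolding choice_iff by blast
  then have isoY: "\<And>i. isometry (Y i)"
    and Y: "\<And>i p h. Y i (neg_monomial p h) = neg_monomial (p(i := Suc (p i))) h"
    by auto
  have funpow: "(Y i ^^ c) (neg_monomial p h) = neg_monomial (p(i := p i + c)) h" for i c p h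
    by (induction c) (simp_all add: Y fun_upd_def cong: if_cong)
  have prod: "op_prod (\<lambda>i. Y i ^^ k i) N (neg_monomial p h)
      = neg_monomial (\<lambda>i. if i \<in> {1..N} then p i + k i else p i) h" for k N p h
  proof (induction N arbitrary: p)
    case (Suc N)
    let ?p = "p(Suc N := p (Suc N) + k (Suc N))"
    have "op_prod (\<lambda>i. Y i ^^ k i) (Suc N) (neg_monomial p h)
        = neg_monomial (\<lambda>i. if i \<in> {1..N} then ?p i + k i else ?p i) h"
      by (simp only: op_prod.simps comp_apply funpow Suc)
    also have "(\<lambda>i. if i \<in> {1..N} then ?p i + k i else ?p i)
        = (\<lambda>i. if i \<in> {1..Suc N} then p i + k i else p i)"
      by (auto simp: fun_eq_iff le_Suc_eq)
    finally show ?case .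
  qed simp
  have monomial: "op_monomial n Y k (neg_monomial p h) = neg_monomial (\<lambda>i. p i + k i) h" for k p h
    unfolding op_monomial_def prod by (subst neg_monomial_cong[where q = "\<lambda>i. p i + k i"]) auto
  have total: "closure (complex_vector.span {neg_monomial (\<lambda>_. j) h | j h. True}) = UNIV"
    using total_Y by (simp add: neg_monomial_const)
  have "commuting n Y"
    unfolding commuting_def
  proof (intro ballI total_isometry_eqI[OF total] isometry_comp isoY)
    fix i j s assume "s \<in> {neg_monomial (\<lambda>_. j) h | j h. True}"
    then show "(Y i \<circ> Y j) s = (Y j \<circ> Y i) s"
      by (cases "i = j") (auto simp: Y fun_upd_twist)
  qed
  moreover have "cinner (op_monomial n Y k (L x)) (L y) = cinner (mS k x) y" for k x y
  proof -
    have L: "L h = neg_monomial (\<lambda>_. 0) h" for h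
      using neg_monomial_const[of 0 h] by simp
    show ?thesis
      by (simp add: L monomial neg_monomial_cinner mV_0 dil_cinner mS_adj)
  qed
  ultimately have "isometric_dilation n L Y S"
    by (simp add: isometric_dilation_iff isometries isoY)
  moreover have "op_prod Y n = Y0"
  proof (rule total_isometry_eqI[OF total isometry_op_prod[OF isoY] isometries(5)], clarify)
    fix j h
    have "op_prod Y n = op_monomial n Y (\<lambda>_. 1)"
      by (simp add: op_monomial_def)
    then have "op_prod Y n (neg_monomial (\<lambda>_. j) h) = neg_monomial (\<lambda>_. Suc j) h"
      by (simp add: monomial)
    then show "op_prod Y n (neg_monomial (\<lambda>_. j) h) = Y0 (neg_monomial (\<lambda>_. j) h)"
      by (simp add: neg_monomial_const)
  qed
  ultimately show ?thesis
    by blast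
qed

end

section \<open>Passing between a tuple and its adjoints\<close>

lemma cinner_cadjoint_left:
  "bounded_clinear A \<Longrightarrow> cinner (cadjoint A x) y = cinner x (A y)"
  by (rule cinner_flip) (rule cinner_cadjoint[symmetric])

lemma cadjoint_op_prod:
  fixes A B :: "nat \<Rightarrow> 'a::chilbert_space \<Rightarrow> 'a"
  assumes "\<And>i x y. i \<in> {1..n} \<Longrightarrow> cinner (A i x) y = cinner x (B i y)" and "commuting n A"
  shows "cadjoint (op_prod A n) = op_prod B n"
proof (rule cadjoint_eqI)
  show "cinner (op_prod A n x) y = cinner x (op_prod B n y)" for x y
    using adjoint_op_monomial[OF assms, of "\<lambda>_. 1"] by (simp add: op_monomial_def)
qed

text \<open>
  The two directions are the same construction, applied to the pair of \<open>T\<close> and its adjoints in either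
  order.  The given minimal dilations \<open>L0, Y0\<close> and \<open>J0, V0\<close> supply the space on which the dual tuple acts.
\<close>

theorem theorem1p2:
  fixes n :: nat
    and T :: "nat \<Rightarrow> 'h::chilbert_space \<Rightarrow> 'h"
    and J0 :: "'h \<Rightarrow> 'k::chilbert_space" and V0 :: "'k \<Rightarrow> 'k"
    and L0 :: "'h \<Rightarrow> 'l::chilbert_space" and Y0 :: "'l \<Rightarrow> 'l"
  assumes "n \<ge> 1"
    and "\<forall>i\<in>{1..n}. contraction (T i)"
    and "commuting n T"
    and "minimal_isometric_dilation1 J0 V0 (op_prod T n)"
    and "minimal_isometric_dilation1 L0 Y0 (cadjoint (op_prod T n))"
  shows "(\<exists>(J :: 'h \<Rightarrow> 'k) V.
            isometric_dilation n J V T \<and>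
            minimal_isometric_dilation1 J (op_prod V n) (op_prod T n)) \<longleftrightarrow>
         (\<exists>(L :: 'h \<Rightarrow> 'l) Y.
            isometric_dilation n L Y (\<lambda>i. cadjoint (T i)) \<and>
            minimal_isometric_dilation1 L (op_prod Y n) (cadjoint (op_prod T n)))"
proof -
  let ?S = "\<lambda>i. cadjoint (T i)"
  have T: "bounded_clinear (T i)" if "i \<in> {1..n}" for i
    using assms(2) that by (auto simp: contraction_def)
  have adj: "cinner (T i x) y = cinner x (?S i y)" if "i \<in> {1..n}" for i x y
    by (rule cinner_cadjoint[OF T[OF that]])
  have adj': "cinner (?S i x) y = cinner x (T i y)" if "i \<in> {1..n}" for i x y
    by (rule cinner_cadjoint_left[OF T[OF that]])
  have comm_S: "commuting n ?S"
    by (rule commuting_adjoint[OF adj assms(3)])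
  have prod: "cadjoint (op_prod T n) = op_prod ?S n"
    by (rule cadjoint_op_prod[OF adj assms(3)])
  show ?thesis
    unfolding prod
  proof
    assume "\<exists>(J :: 'h \<Rightarrow> 'k) V. isometric_dilation n J V T \<and>
      minimal_isometric_dilation1 J (op_prod V n) (op_prod T n)"
    then obtain J :: "'h \<Rightarrow> 'k" and V where "isometric_dilation n J V T"
        "minimal_isometric_dilation1 J (op_prod V n) (op_prod T n)"
      by blast
    then interpret dual_dilations n T ?S J V L0 Y0
      using adj assms(3,5) by unfold_locales (auto simp: prod)
    show "\<exists>(L :: 'h \<Rightarrow> 'l) Y. isometric_dilation n L Y ?S \<and>
        minimal_isometric_dilation1 L (op_prod Y n) (op_prod ?S n)"
      using dual_dilation_exists min_Y by metis
  next
    assume "\<exists>(L :: 'h \<Rightarrow> 'l) Y. isometric_dilation n L Y ?S \<and>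
      minimal_isometric_dilation1 L (op_prod Y n) (op_prod ?S n)"
    then obtain L :: "'h \<Rightarrow> 'l" and Y where "isometric_dilation n L Y ?S"
        "minimal_isometric_dilation1 L (op_prod Y n) (op_prod ?S n)"
      by blast
    then interpret dual_dilations n ?S T L Y J0 V0
      using adj' comm_S assms(4) by unfold_locales auto
    show "\<exists>(J :: 'h \<Rightarrow> 'k) V. isometric_dilation n J V T \<and>
        minimal_isometric_dilation1 J (op_prod V n) (op_prod T n)"
      using dual_dilation_exists min_Y by metis
  qed
qed

end
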